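(* Let $b>a>0$ and define $g_{a,b}:\mathbb{R}\to(0,\infty)$ by $g_{a,b}(t)=\frac{b^t-a^t}{t}$ for $t\neq0$ and $g_{a,b}(0)=b-a$. Then: (i) $g_{a,b}$ is logarithmically convex on $(-\infty,\infty)$, i.e. $[\ln g_{a,b}(t)]''\ge 0$ for all $t\in\mathbb{R}$; (ii) $g_{a,b}$ is $3$-log-convex on $(-\infty,0)$ and $3$-log-concave on $(0,\infty)$, i.e. $[\ln g_{a,b}(t)]'''\ge0$ for $t<0$ and $[\ln g_{a,b}(t)]'''\le0$ for $t>0$; (iii) the function $$h_{a,b}(t)=\begin{cases}\dfrac{b^t\ln b-a^t\ln a}{b^t-a^t}-\dfrac1t,& t\neq0,\\[0.5em] \ln\sqrt{ab},& t=0\end{cases}$$ (which equals $[\ln g_{a,b}(t)]'$) is increasing on $(-\infty,\infty)$ and satisfies $\lim_{t\to-\infty}h_{a,b}(t)=\ln a$ and $\lim_{t\to\infty}h_{a,b}(t)=\ln b$.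
   Context: A $k$-times differentiable function $f>0$ on an interval $I$ is called $k$-log-convex on $I$ if $[\ln f(t)]^{(k)}\ge0$ on $I$, and $k$-log-concave on $I$ if $[\ln f(t)]^{(k)}\le0$ on $I$. Logarithmic convexity means $2$-log-convexity. *)

theory Defs
  imports "HOL-Analysis.Analysis"
begin

definition k_times_differentiable_on :: "nat \<Rightarrow> (real \<Rightarrow> real) \<Rightarrow> real set \<Rightarrow> bool" where
  "k_times_differentiable_on k f I \<longleftrightarrow>
     (\<forall>j<k. \<forall>t\<in>I. (deriv ^^ j) f differentiable (at t))"

definition k_log_convex :: "nat \<Rightarrow> (real \<Rightarrow> real) \<Rightarrow> real set \<Rightarrow> bool" where
  "k_log_convex k f I \<longleftrightarrow> (\<forall>t\<in>I. f t > 0) \<and> k_times_differentiable_on k f I \<and>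
     (\<forall>t\<in>I. (deriv ^^ k) (\<lambda>s. ln (f s)) t \<ge> 0)"

definition k_log_concave :: "nat \<Rightarrow> (real \<Rightarrow> real) \<Rightarrow> real set \<Rightarrow> bool" where
  "k_log_concave k f I \<longleftrightarrow> (\<forall>t\<in>I. f t > 0) \<and> k_times_differentiable_on k f I \<and>
     (\<forall>t\<in>I. (deriv ^^ k) (\<lambda>s. ln (f s)) t \<le> 0)"

text \<open>g_{a,b}; the value at 0 is the continuous extension ln b - ln a.\<close>
definition g_ab :: "real \<Rightarrow> real \<Rightarrow> real \<Rightarrow> real" where
  "g_ab a b t = (if t = 0 then ln b - ln a else (b powr t - a powr t) / t)"

definition h_ab :: "real \<Rightarrow> real \<Rightarrow> real \<Rightarrow> real" where
  "h_ab a b t = (if t = 0 then ln (sqrt (a * b))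
     else (b powr t * ln b - a powr t * ln a) / (b powr t - a powr t) - 1 / t)"

end

theory Submission
  imports Defs "HOL-Real_Asymp.Real_Asymp"
begin

(* With alpha = ln a and c = ln b - ln a > 0 we have
     g_{a,b}(t) = c * e^(alpha t) * E(c t),   E(u) = (e^u - 1)/u,  E(0) = 1,
   hence ln g_{a,b}(t) = ln c + alpha t + ln E(c t), and everything reduces to the
   logarithmic derivative L = E'/E of the exponential difference quotient E:
     (i)   L' >= 0, equivalently u^2 e^u <= (e^u - 1)^2, i.e. |v| <= |sinh v| for v = u/2;
     (ii)  L'' <= 0 on (0,oo) and L'' >= 0 on (-oo,0), equivalently v^3 cosh v <= sinh^3 v
           for v >= 0 (and the reverse for v <= 0, by oddness);
     (iii) h_{a,b}(t) = alpha + c L(c t), and L increases from 0 at -oo to 1 at +oo.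
   The hyperbolic cube inequality comes from the monotonicity of sinh x / cosh^(1/3) x - x,
   whose derivative is (s^2 - 1)^2 (2 s^2 + 1) / (3 s^4) >= 0 with s = cosh^(1/3) x. *)

lemma cbrt_cosh_cube: "(cosh x powr (1/3)) ^ 3 = cosh (x :: real)"
  using cosh_real_pos [of x] by (simp add: powr_power)

lemma cbrt_cosh_has_derivative:
  "((\<lambda>y. cosh y powr (1/3)) has_real_derivative cosh x powr (1/3) * sinh x / (3 * cosh x)) (at (x :: real))"
proof -
  have "cosh x powr (1/3) = cosh x powr 1 * cosh x powr (- (2/3))"
    using powr_add [of "cosh x" 1 "- (2/3)"] by simp
  then have "cosh x powr (- (2/3)) = cosh x powr (1/3) / cosh x"
    using cosh_real_pos [of x] by (simp add: field_simps)
  then show ?thesis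
    by (auto intro!: derivative_eq_intros simp: cosh_real_pos)
qed

text \<open>Arithmetic-geometric mean inequality for \<open>s\<^sup>6, s\<^sup>6, 1\<close>; it is the sign of the
  derivative in the next lemma.\<close>

lemma am_gm_pow4_pow6: "3 * s ^ 4 \<le> 2 * s ^ 6 + (1 :: real)"
proof -
  have "2 * s ^ 6 + 1 - 3 * s ^ 4 = (s\<^sup>2 - 1)\<^sup>2 * (2 * s\<^sup>2 + 1)"
    by algebra
  moreover have "0 \<le> (s\<^sup>2 - 1)\<^sup>2 * (2 * s\<^sup>2 + 1)"
    by (intro mult_nonneg_nonneg) simp_all
  ultimately show ?thesis by linarith
qed

text \<open>The key hyperbolic inequality \<open>x cosh\<^sup>1\<^sup>/\<^sup>3 x \<le> sinh x\<close> for \<open>x \<ge> 0\<close>: the function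
  \<open>sinh x / cosh\<^sup>1\<^sup>/\<^sup>3 x - x\<close> vanishes at 0 and has nonnegative derivative.\<close>

lemma sinh_ge_x_cbrt_cosh:
  fixes x :: real
  assumes "0 \<le> x"
  shows "x * cosh x powr (1/3) \<le> sinh x"
proof -
  define S where "S y = cosh y powr (1/3)" for y :: real
  have S_pos: "S y > 0" for y
    unfolding S_def by (simp add: cosh_real_pos)
  have dS: "(S has_real_derivative S y * sinh y / (3 * cosh y)) (at y)" for y
    unfolding S_def [abs_def] by (rule cbrt_cosh_has_derivative)
  define p where "p y = sinh y / S y - y" for y
  have dp: "(p has_real_derivative (2 * S y ^ 6 + 1) / (3 * S y ^ 4) - 1) (at y)" for y
  proof -
    have "(p has_real_derivative
        (cosh y * S y - sinh y * (S y * sinh y / (3 * cosh y))) / (S y * S y) - 1) (at y)"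
      unfolding p_def
      by (auto intro!: derivative_eq_intros dS simp: S_pos [THEN less_imp_neq, symmetric])
    moreover have "(cosh y * S y - sinh y * (S y * sinh y / (3 * cosh y))) / (S y * S y)
        = (2 * S y ^ 6 + 1) / (3 * S y ^ 4)"
    proof -
      have cube: "cosh y = S y ^ 3"
        unfolding S_def by (rule cbrt_cosh_cube [symmetric])
      then have "cosh y ^ 2 = S y ^ 6"
        by (simp add: power_mult [symmetric])
      then have "sinh y ^ 2 = S y ^ 6 - 1"
        by (simp add: sinh_square_eq)
      then show ?thesis
        using S_pos [of y] cube by (simp add: field_simps power2_eq_square) algebra
    qed
    ultimately show ?thesis by simp
  qed
  have dp_nonneg: "0 \<le> (2 * S y ^ 6 + 1) / (3 * S y ^ 4) - 1" for y
    using am_gm_pow4_pow6 [of "S y"] S_pos [of y] by simp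
  have "p 0 \<le> p x"
    by (rule DERIV_nonneg_imp_nondecreasing [OF assms]) (use dp dp_nonneg in blast)
  then show ?thesis
    using S_pos [of x] by (simp add: p_def S_def field_simps)
qed

lemma x_cube_cosh_le_sinh_cube:
  fixes v :: real
  assumes "0 \<le> v"
  shows "v ^ 3 * cosh v \<le> sinh v ^ 3"
proof -
  have "(v * cosh v powr (1/3)) ^ 3 \<le> sinh v ^ 3"
    using sinh_ge_x_cbrt_cosh [OF assms] assms by (intro power_mono) simp_all
  then show ?thesis
    by (simp add: power_mult_distrib cbrt_cosh_cube)
qed

lemma sinh_cube_le_x_cube_cosh:
  fixes v :: real
  assumes "v \<le> 0"
  shows "sinh v ^ 3 \<le> v ^ 3 * cosh v"
  using x_cube_cosh_le_sinh_cube [of "- v"] assms by simp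

text \<open>Half-angle form of \<open>exp u - 1\<close>; it turns \<open>exp u / (exp u - 1)\<^sup>2\<close> into
  \<open>1 / (4 sinh\<^sup>2 (u/2))\<close> in the closed form of \<open>ldq1\<close> below.\<close>

lemma exp_minus_one_eq_sinh_half: "exp u - 1 = 2 * exp (u/2) * sinh (u/2 :: real)"
proof -
  have "exp u = exp (u/2) * exp (u/2)" by (simp add: exp_add [symmetric])
  then show ?thesis by (simp add: sinh_field_def exp_minus field_simps)
qed

definition dq :: "real \<Rightarrow> real" where
  "dq u = (if u = 0 then 1 else (exp u - 1) / u)"

definition dq1 :: "real \<Rightarrow> real" where
  "dq1 u = (if u = 0 then 1/2 else (u * exp u - exp u + 1) / u\<^sup>2)"

definition dq2 :: "real \<Rightarrow> real" where
  "dq2 u = (if u = 0 then 1/3 else (u\<^sup>2 * exp u - 2 * u * exp u + 2 * exp u - 2) / u ^ 3)"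

lemma dq_pos: "0 < dq u"
proof (cases "u = 0")
  case False
  then have "0 < (exp u - 1) / u"
    by (cases "u > 0") (auto simp: divide_neg_neg zero_less_divide_iff)
  with False show ?thesis by (simp add: dq_def)
qed (simp add: dq_def)

lemma eventually_nonzero_at_0: "\<forall>\<^sub>F h in at (0::real). h \<noteq> 0"
  by (simp add: eventually_at_filter)

lemma dq_has_derivative: "(dq has_real_derivative dq1 u) (at u)"
proof (cases "u = 0")
  case True
  have "((\<lambda>h. (dq (0 + h) - dq 0) / h) \<longlongrightarrow> 1/2) (at 0)"
  proof (subst tendsto_cong)
    show "\<forall>\<^sub>F h in at 0. (dq (0 + h) - dq 0) / h = ((exp h - 1) / h - 1) / h"
      using eventually_nonzero_at_0 by eventually_elim (simp add: dq_def)
    show "((\<lambda>h::real. ((exp h - 1) / h - 1) / h) \<longlongrightarrow> 1/2) (at 0)"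
      by real_asymp
  qed
  with True show ?thesis by (simp add: DERIV_def dq1_def)
next
  case False
  have "((\<lambda>x. (exp x - 1) / x) has_real_derivative dq1 u) (at u)"
    using False by (auto intro!: derivative_eq_intros simp: dq1_def power2_eq_square algebra_simps)
  then show ?thesis
    by (rule has_field_derivative_transform_within_open [where S = "- {0}"])
       (use False in \<open>auto simp: dq_def\<close>)
qed

lemma dq1_has_derivative: "(dq1 has_real_derivative dq2 u) (at u)"
proof (cases "u = 0")
  case True
  have "((\<lambda>h. (dq1 (0 + h) - dq1 0) / h) \<longlongrightarrow> 1/3) (at 0)"
  proof (subst tendsto_cong)
    show "\<forall>\<^sub>F h in at 0. (dq1 (0 + h) - dq1 0) / h = ((h * exp h - exp h + 1) / h\<^sup>2 - 1/2) / h"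
      using eventually_nonzero_at_0 by eventually_elim (simp add: dq1_def)
    show "((\<lambda>h::real. ((h * exp h - exp h + 1) / h\<^sup>2 - 1/2) / h) \<longlongrightarrow> 1/3) (at 0)"
      by real_asymp
  qed
  with True show ?thesis by (simp add: DERIV_def dq2_def)
next
  case False
  have "((\<lambda>x. (x * exp x - exp x + 1) / x\<^sup>2) has_real_derivative dq2 u) (at u)"
    using False
    by (auto intro!: derivative_eq_intros simp: dq2_def power2_eq_square power3_eq_cube field_simps)
  then show ?thesis
    by (rule has_field_derivative_transform_within_open [where S = "- {0}"])
       (use False in \<open>auto simp: dq1_def\<close>)
qed

definition ldq :: "real \<Rightarrow> real" where
  "ldq u = dq1 u / dq u"

definition ldq1 :: "real \<Rightarrow> real" where
  "ldq1 u = (dq2 u * dq u - dq1 u * dq1 u) / (dq u)\<^sup>2"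

definition ldq2 :: "real \<Rightarrow> real" where
  "ldq2 u = (cosh (u/2) / sinh (u/2) ^ 3 - 1 / (u/2) ^ 3) / 4"

lemma ldq_has_derivative: "(ldq has_real_derivative ldq1 u) (at u)"
  unfolding ldq_def [abs_def] ldq1_def
  using DERIV_divide [OF dq1_has_derivative dq_has_derivative, of u] dq_pos [of u]
  by (simp add: power2_eq_square)

lemma ldq_closed: "u \<noteq> 0 \<Longrightarrow> ldq u = exp u / (exp u - 1) - 1 / u"
  by (simp add: ldq_def dq_def dq1_def field_simps power2_eq_square)

lemma ldq1_closed: "u \<noteq> 0 \<Longrightarrow> ldq1 u = 1 / u\<^sup>2 - 1 / (4 * sinh (u/2) ^ 2)"
proof -
  assume u: "u \<noteq> 0"
  define X where "X = exp u"
  have X: "X - 1 \<noteq> 0" using u by (simp add: X_def)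
  have "ldq1 u = ((u\<^sup>2 * X - 2 * u * X + 2 * X - 2) / u ^ 3 * ((X - 1) / u)
      - ((u * X - X + 1) / u\<^sup>2) * ((u * X - X + 1) / u\<^sup>2)) / ((X - 1) / u)\<^sup>2"
    using u by (simp add: ldq1_def dq_def dq1_def dq2_def X_def)
  also have "\<dots> = 1 / u\<^sup>2 - X / (X - 1)\<^sup>2"
    using u X by (simp add: field_simps) algebra
  also have "X / (X - 1)\<^sup>2 = 1 / (4 * sinh (u/2) ^ 2)"
  proof -
    have "X = exp (u/2) ^ 2" by (simp add: X_def power2_eq_square exp_add [symmetric])
    then show ?thesis
      using X unfolding X_def exp_minus_one_eq_sinh_half [of u] by (simp add: field_simps power2_eq_square)
  qed
  finally show ?thesis .
qed

lemma ldq1_has_derivative: "u \<noteq> 0 \<Longrightarrow> (ldq1 has_real_derivative ldq2 u) (at u)"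
proof -
  assume u: "u \<noteq> 0"
  have "((\<lambda>x. 1 / x\<^sup>2 - 1 / (4 * sinh (x/2) ^ 2)) has_real_derivative ldq2 u) (at u)"
    using u by (auto intro!: derivative_eq_intros simp: ldq2_def field_simps power2_eq_square power3_eq_cube)
  then show ?thesis
    by (rule has_field_derivative_transform_within_open [where S = "- {0}"])
       (use u in \<open>auto simp: ldq1_closed\<close>)
qed

text \<open>Log-convexity of \<open>dq\<close>: \<open>ldq1 \<ge> 0\<close>, from \<open>|v| \<le> |sinh v|\<close> (value 1/12 at 0).\<close>

lemma ldq1_nonneg: "0 \<le> ldq1 u"
proof (cases "u = 0")
  case True
  then show ?thesis by (simp add: ldq1_def dq_def dq1_def dq2_def)
next
  case False
  have "\<bar>u/2\<bar> \<le> \<bar>sinh (u/2)\<bar>"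
    using real_le_abs_sinh [of "u/2"] by (simp add: sinh_field_def exp_minus)
  then have "(u/2)\<^sup>2 \<le> sinh (u/2) ^ 2"
    by (simp only: abs_le_square_iff)
  moreover have "0 < (u/2)\<^sup>2" using False by simp
  ultimately have "1 / (4 * sinh (u/2) ^ 2) \<le> 1 / u\<^sup>2"
    by (simp add: frac_le power_divide)
  with False show ?thesis
    by (simp add: ldq1_closed)
qed

lemma ldq2_nonpos: "0 < u \<Longrightarrow> ldq2 u \<le> 0"
proof -
  assume "0 < u"
  then have v: "0 < u/2" by simp
  then have pos: "0 < sinh (u/2) ^ 3" "0 < (u/2) ^ 3" by simp_all
  have "cosh (u/2) / sinh (u/2) ^ 3 = ((u/2) ^ 3 * cosh (u/2)) / ((u/2) ^ 3 * sinh (u/2) ^ 3)"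
    using pos by simp
  also have "\<dots> \<le> sinh (u/2) ^ 3 / ((u/2) ^ 3 * sinh (u/2) ^ 3)"
    using x_cube_cosh_le_sinh_cube [of "u/2"] v pos by (intro divide_right_mono) simp_all
  also have "\<dots> = 1 / (u/2) ^ 3"
    using pos by simp
  finally show ?thesis by (simp add: ldq2_def)
qed

lemma ldq2_nonneg: "u < 0 \<Longrightarrow> 0 \<le> ldq2 u"
proof -
  assume "u < 0"
  then have v: "u/2 < 0" by simp
  then have neg: "sinh (u/2) ^ 3 < 0" "(u/2) ^ 3 < 0" by (simp_all add: odd_power_less_zero)
  then have prod_pos: "0 < (u/2) ^ 3 * sinh (u/2) ^ 3" by (simp add: mult_neg_neg)
  have "1 / (u/2) ^ 3 = sinh (u/2) ^ 3 / ((u/2) ^ 3 * sinh (u/2) ^ 3)"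
    using neg by simp
  also have "\<dots> \<le> ((u/2) ^ 3 * cosh (u/2)) / ((u/2) ^ 3 * sinh (u/2) ^ 3)"
    using sinh_cube_le_x_cube_cosh [of "u/2"] v prod_pos by (intro divide_right_mono) simp_all
  also have "\<dots> = cosh (u/2) / sinh (u/2) ^ 3"
    using neg by simp
  finally show ?thesis by (simp add: ldq2_def)
qed

lemma ldq_mono: "mono ldq"
proof (rule monoI)
  fix x y :: real
  assume "x \<le> y"
  then show "ldq x \<le> ldq y"
    by (rule DERIV_nonneg_imp_nondecreasing) (use ldq_has_derivative ldq1_nonneg in blast)
qed

lemma ldq_at_top: "(ldq \<longlongrightarrow> 1) at_top"
proof (subst tendsto_cong)
  show "\<forall>\<^sub>F u in at_top. ldq u = exp u / (exp u - 1) - 1 / u"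
    using eventually_gt_at_top [of 0] by eventually_elim (simp add: ldq_closed)
  show "((\<lambda>u::real. exp u / (exp u - 1) - 1 / u) \<longlongrightarrow> 1) at_top" by real_asymp
qed

lemma ldq_at_bot: "(ldq \<longlongrightarrow> 0) at_bot"
proof (subst tendsto_cong)
  show "\<forall>\<^sub>F u in at_bot. ldq u = exp u / (exp u - 1) - 1 / u"
    using eventually_at_bot_not_equal [of 0] by eventually_elim (simp add: ldq_closed)
  show "((\<lambda>u::real. exp u / (exp u - 1) - 1 / u) \<longlongrightarrow> 0) at_bot" by real_asymp
qed

text \<open>The scaled functions \<open>gfun \<alpha> c t = c exp (\<alpha> t) dq (c t)\<close>, which equals
  \<open>(exp ((\<alpha> + c) t) - exp (\<alpha> t)) / t\<close> for \<open>t \<noteq> 0\<close>, and \<open>hfun \<alpha> c\<close>, the derivative of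
  \<open>ln (gfun \<alpha> c)\<close>.  The functions of the theorem are the case \<open>\<alpha> = ln a\<close>, \<open>c = ln b - ln a\<close>.\<close>

definition gfun :: "real \<Rightarrow> real \<Rightarrow> real \<Rightarrow> real" where
  "gfun \<alpha> c t = c * exp (\<alpha> * t) * dq (c * t)"

definition hfun :: "real \<Rightarrow> real \<Rightarrow> real \<Rightarrow> real" where
  "hfun \<alpha> c t = \<alpha> + c * ldq (c * t)"

lemma gfun_pos: "0 < c \<Longrightarrow> 0 < gfun \<alpha> c t"
  by (simp add: gfun_def dq_pos)

lemma gfun_has_derivative: "(gfun \<alpha> c has_real_derivative gfun \<alpha> c t * hfun \<alpha> c t) (at t)"
proof -
  have "(gfun \<alpha> c has_real_derivative
      c * (\<alpha> * exp (\<alpha> * t) * dq (c * t) + exp (\<alpha> * t) * (dq1 (c * t) * c))) (at t)"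
    unfolding gfun_def [abs_def]
    by (rule derivative_eq_intros DERIV_chain2 [OF dq_has_derivative] refl | simp add: algebra_simps)+
  moreover have "gfun \<alpha> c t * hfun \<alpha> c t
      = c * (\<alpha> * exp (\<alpha> * t) * dq (c * t) + exp (\<alpha> * t) * (dq1 (c * t) * c))"
    using dq_pos [of "c * t"] by (simp add: gfun_def hfun_def ldq_def field_simps)
  ultimately show ?thesis by simp
qed

lemma ln_gfun_has_derivative:
  "0 < c \<Longrightarrow> ((\<lambda>s. ln (gfun \<alpha> c s)) has_real_derivative hfun \<alpha> c t) (at t)"
  using DERIV_chain2 [OF DERIV_ln [OF gfun_pos] gfun_has_derivative, of c \<alpha> t] gfun_pos [of c \<alpha> t]
  by (simp add: field_simps)

lemma hfun_has_derivative: "(hfun \<alpha> c has_real_derivative c\<^sup>2 * ldq1 (c * t)) (at t)"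
  unfolding hfun_def [abs_def]
  by (rule derivative_eq_intros DERIV_chain2 [OF ldq_has_derivative] refl | simp add: power2_eq_square)+

lemma hfun_deriv_has_derivative:
  "c * t \<noteq> 0 \<Longrightarrow> ((\<lambda>s. c\<^sup>2 * ldq1 (c * s)) has_real_derivative c ^ 3 * ldq2 (c * t)) (at t)"
  by (rule derivative_eq_intros DERIV_chain2 [OF ldq1_has_derivative] refl | simp add: power3_eq_cube power2_eq_square)+

lemma deriv_ln_gfun: "0 < c \<Longrightarrow> deriv (\<lambda>s. ln (gfun \<alpha> c s)) = hfun \<alpha> c"
  by (intro ext DERIV_imp_deriv ln_gfun_has_derivative)

lemma deriv2_ln_gfun:
  assumes "0 < c"
  shows "(deriv ^^ 2) (\<lambda>s. ln (gfun \<alpha> c s)) = (\<lambda>t. c\<^sup>2 * ldq1 (c * t))"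
proof -
  have "deriv (hfun \<alpha> c) = (\<lambda>t. c\<^sup>2 * ldq1 (c * t))"
    by (intro ext DERIV_imp_deriv hfun_has_derivative)
  then show ?thesis
    using deriv_ln_gfun [OF assms] by (simp add: numeral_2_eq_2)
qed

lemma deriv3_ln_gfun:
  assumes "0 < c" and "t \<noteq> 0"
  shows "(deriv ^^ 3) (\<lambda>s. ln (gfun \<alpha> c s)) t = c ^ 3 * ldq2 (c * t)"
proof -
  have "(deriv ^^ 3) (\<lambda>s. ln (gfun \<alpha> c s)) = deriv ((deriv ^^ 2) (\<lambda>s. ln (gfun \<alpha> c s)))"
    by (simp add: eval_nat_numeral)
  then show ?thesis
    using DERIV_imp_deriv [OF hfun_deriv_has_derivative] assms by (simp add: deriv2_ln_gfun)
qed

text \<open>The smoothness required by \<open>k_times_differentiable_on\<close> concerns \<open>gfun\<close> itself: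
  \<open>gfun'' = gfun (hfun\<^sup>2 + hfun')\<close> is differentiable wherever \<open>hfun'\<close> is, i.e. off 0.\<close>

lemma gfun_hfun_has_derivative:
  "((\<lambda>s. gfun \<alpha> c s * hfun \<alpha> c s) has_real_derivative
     gfun \<alpha> c t * (hfun \<alpha> c t * hfun \<alpha> c t + c\<^sup>2 * ldq1 (c * t))) (at t)"
  using DERIV_mult [OF gfun_has_derivative [of \<alpha> c t] hfun_has_derivative [of \<alpha> c t]]
  by (simp add: algebra_simps)

lemma deriv_gfun: "deriv (gfun \<alpha> c) = (\<lambda>t. gfun \<alpha> c t * hfun \<alpha> c t)"
  by (intro ext DERIV_imp_deriv gfun_has_derivative)

lemma deriv2_gfun:
  "(deriv ^^ 2) (gfun \<alpha> c) = (\<lambda>t. gfun \<alpha> c t * (hfun \<alpha> c t * hfun \<alpha> c t + c\<^sup>2 * ldq1 (c * t)))"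
proof -
  have "deriv (\<lambda>t. gfun \<alpha> c t * hfun \<alpha> c t)
      = (\<lambda>t. gfun \<alpha> c t * (hfun \<alpha> c t * hfun \<alpha> c t + c\<^sup>2 * ldq1 (c * t)))"
    by (intro ext DERIV_imp_deriv gfun_hfun_has_derivative)
  then show ?thesis by (simp add: numeral_2_eq_2 deriv_gfun)
qed

lemma gfun_twice_differentiable: "k_times_differentiable_on 2 (gfun \<alpha> c) UNIV"
proof -
  have "(deriv ^^ j) (gfun \<alpha> c) differentiable (at t)" if "j < 2" for j t
  proof -
    have "j = 0 \<or> j = 1" using that by linarith
    then show ?thesis
      unfolding real_differentiable_def
      by (elim disjE) (auto simp: deriv_gfun intro: gfun_has_derivative gfun_hfun_has_derivative)
  qed
  then show ?thesis by (simp add: k_times_differentiable_on_def)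
qed

lemma gfun_thrice_differentiable:
  assumes "0 < c" and "0 \<notin> I"
  shows "k_times_differentiable_on 3 (gfun \<alpha> c) I"
  unfolding k_times_differentiable_on_def
proof (intro allI impI ballI)
  fix j :: nat and t :: real
  assume j: "j < 3" and "t \<in> I"
  then have "c * t \<noteq> 0" using assms by auto
  show "(deriv ^^ j) (gfun \<alpha> c) differentiable (at t)"
  proof (cases "j = 2")
    case True
    from DERIV_mult [OF gfun_has_derivative DERIV_add [OF
        DERIV_mult [OF hfun_has_derivative hfun_has_derivative] hfun_deriv_has_derivative [OF \<open>c * t \<noteq> 0\<close>]]]
    show ?thesis unfolding True deriv2_gfun real_differentiable_def by (rule exI)
  next
    case False
    with j have "j < 2" by linarith
    with gfun_twice_differentiable [of \<alpha> c] show ?thesis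
      unfolding k_times_differentiable_on_def by blast
  qed
qed

lemma gfun_log_convex: "0 < c \<Longrightarrow> k_log_convex 2 (gfun \<alpha> c) UNIV"
  unfolding k_log_convex_def
  using gfun_pos gfun_twice_differentiable ldq1_nonneg by (simp add: deriv2_ln_gfun)

lemma gfun_3_log_convex_neg: "0 < c \<Longrightarrow> k_log_convex 3 (gfun \<alpha> c) {..<0}"
  unfolding k_log_convex_def
  using gfun_pos gfun_thrice_differentiable ldq2_nonneg
  by (simp add: deriv3_ln_gfun mult_pos_neg)

lemma gfun_3_log_concave_pos: "0 < c \<Longrightarrow> k_log_concave 3 (gfun \<alpha> c) {0<..}"
  unfolding k_log_concave_def
  using gfun_pos gfun_thrice_differentiable ldq2_nonpos
  by (simp add: deriv3_ln_gfun mult_nonneg_nonpos)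

lemma hfun_mono: "0 \<le> c \<Longrightarrow> mono (hfun \<alpha> c)"
  using ldq_mono unfolding hfun_def mono_def by (simp add: mult_left_mono)

lemma hfun_at_top: "0 < c \<Longrightarrow> (hfun \<alpha> c \<longlongrightarrow> \<alpha> + c) at_top"
proof -
  assume c: "0 < c"
  have "filterlim (\<lambda>t. c * t) at_top at_top"
    using c by (intro filterlim_tendsto_pos_mult_at_top [OF tendsto_const] filterlim_ident)
  then have "((\<lambda>t. ldq (c * t)) \<longlongrightarrow> 1) at_top"
    by (rule filterlim_compose [OF ldq_at_top])
  then have "((\<lambda>t. \<alpha> + c * ldq (c * t)) \<longlongrightarrow> \<alpha> + c * 1) at_top"
    by (intro tendsto_intros)
  then show ?thesis by (simp add: hfun_def [abs_def])
qed

lemma hfun_at_bot: "0 < c \<Longrightarrow> (hfun \<alpha> c \<longlongrightarrow> \<alpha>) at_bot"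
proof -
  assume c: "0 < c"
  have "filterlim (\<lambda>t. c * t) at_bot at_bot"
    using c by (intro filterlim_tendsto_pos_mult_at_bot [OF tendsto_const] filterlim_ident)
  then have "((\<lambda>t. ldq (c * t)) \<longlongrightarrow> 0) at_bot"
    by (rule filterlim_compose [OF ldq_at_bot])
  then have "((\<lambda>t. \<alpha> + c * ldq (c * t)) \<longlongrightarrow> \<alpha> + c * 0) at_bot"
    by (intro tendsto_intros)
  then show ?thesis by (simp add: hfun_def [abs_def])
qed

lemma powr_as_exp:
  fixes a b t :: real
  assumes "0 < a" and "0 < b"
  shows "a powr t = exp (ln a * t)" and "b powr t = exp (ln a * t) * exp ((ln b - ln a) * t)"
proof -
  show "a powr t = exp (ln a * t)"
  proof -
    have "a powr t = exp (t * ln a)" using assms by (simp add: powr_def)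
    then show ?thesis by (simp only: mult.commute)
  qed
  have "exp (ln a * t) * exp ((ln b - ln a) * t) = exp (t * ln b)"
    by (simp add: exp_add [symmetric] algebra_simps)
  moreover have "b powr t = exp (t * ln b)" using assms by (simp add: powr_def)
  ultimately show "b powr t = exp (ln a * t) * exp ((ln b - ln a) * t)" by simp
qed

lemma g_ab_eq_gfun:
  assumes "0 < a" and "0 < b"
  shows "g_ab a b = gfun (ln a) (ln b - ln a)"
proof
  fix t
  show "g_ab a b t = gfun (ln a) (ln b - ln a) t"
  proof (cases "(ln b - ln a) * t = 0")
    case True
    then show ?thesis
      using powr_as_exp [OF assms, of t] by (auto simp: g_ab_def gfun_def dq_def)
  next
    case False
    then show ?thesis
      using powr_as_exp [OF assms, of t] by (simp add: g_ab_def gfun_def dq_def field_simps)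
  qed
qed

lemma h_ab_eq_hfun:
  assumes "0 < a" and "0 < b" and "a \<noteq> b"
  shows "h_ab a b = hfun (ln a) (ln b - ln a)"
proof
  fix t
  define c where "c = ln b - ln a"
  have c: "c \<noteq> 0" using assms by (simp add: c_def)
  have lnb: "ln b = ln a + c" by (simp add: c_def)
  show "h_ab a b t = hfun (ln a) (ln b - ln a) t"
  proof (cases "t = 0")
    case True
    have "ln (sqrt (a * b)) = ln a + c / 2"
      using assms by (simp add: ln_sqrt ln_mult lnb)
    with True show ?thesis
      by (simp add: h_ab_def hfun_def ldq_def dq_def dq1_def c_def [symmetric])
  next
    case False
    define E X where "E = exp (ln a * t)" and "X = exp (c * t)"
    have ct: "c * t \<noteq> 0" using c False by simp
    then have X: "X - 1 \<noteq> 0" by (simp add: X_def)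
    have E: "E \<noteq> 0" by (simp add: E_def)
    note powr = powr_as_exp [OF assms(1,2), of t, folded c_def, folded E_def X_def]
    have "h_ab a b t = (E * X * ln b - E * ln a) / (E * X - E) - 1 / t"
      using False by (simp add: h_ab_def powr)
    also have "\<dots> = (X * (ln a + c) - ln a) / (X - 1) - 1 / t"
      using E X by (simp add: lnb field_simps)
    also have "\<dots> = ln a + c * (X / (X - 1) - 1 / (c * t))"
      using False c X by (simp add: field_simps)
    also have "\<dots> = hfun (ln a) (ln b - ln a) t"
      by (simp add: hfun_def ldq_closed [OF ct] X_def c_def [symmetric])
    finally show ?thesis .
  qed
qed

theorem theorem1:
  fixes a b :: real
  assumes "0 < a" and "a < b"
  shows "k_log_convex 2 (g_ab a b) UNIV
    \<and> (k_log_convex 3 (g_ab a b) {..<0} \<and> k_log_concave 3 (g_ab a b) {0<..})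
    \<and> ((\<forall>t. ((\<lambda>s. ln (g_ab a b s)) has_real_derivative h_ab a b t) (at t))
       \<and> mono (h_ab a b)
       \<and> (h_ab a b \<longlongrightarrow> ln a) at_bot
       \<and> (h_ab a b \<longlongrightarrow> ln b) at_top)"
proof -
  define \<alpha> c where "\<alpha> = ln a" and "c = ln b - ln a"
  have c: "0 < c" using assms by (simp add: c_def)
  have g: "g_ab a b = gfun \<alpha> c" and h: "h_ab a b = hfun \<alpha> c"
    using assms g_ab_eq_gfun h_ab_eq_hfun by (simp_all add: \<alpha>_def c_def)
  have "(hfun \<alpha> c \<longlongrightarrow> ln b) at_top"
    using hfun_at_top [OF c, of \<alpha>] by (simp add: \<alpha>_def c_def)
  then show ?thesis
    unfolding g h
    using gfun_log_convex [OF c] gfun_3_log_convex_neg [OF c] gfun_3_log_concave_pos [OF c]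
      ln_gfun_has_derivative [OF c] hfun_mono [of c] hfun_at_bot [OF c] c
    by (simp add: \<alpha>_def)
qed

end
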